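(* Let $M\ge 1$ and let $Q(x)=\sum_{j=0}^M a_jx^j$ be a real polynomial of degree $M$ with $M$ real zeros, each of multiplicity $1$. Let $B=(B_{l,n})_{l,n\ge 0}$ be the inverse of the upper triangular transition matrix $A=(A_{l,n})_{l,n\geq 0}$ defined by $\phi_n(x)=\sum_{l} A_{l,n}x^l$, where the polynomials $\phi_n$ are as defined in the context; equivalently $x^n=\sum_{l=0}^n B_{l,n}\phi_l(x)$. Then for every integer $n>M-2$, on every open interval on which $Q>0$, $$\int \frac{x^n\,dx}{\sqrt{Q(x)}}=\sum_{l=0}^{M-2}B_{l,n}I_l+2\sum_{l=M-1}^n B_{l,n}\, x^{l+1-M}\sqrt{Q(x)}+C .$$
   Context: $I_l=\int \frac{x^l\,dx}{\sqrt{Q(x)}}$ denotes an antiderivative of $x^l/\sqrt{Q(x)}$ (on the interval considered), and $C$ is a constant of integration. A sum over an empty range is $0$. The basis $(\phi_n)_{n\ge 0}$ of the space of real polynomials is defined by $$\phi_n(x)=\begin{cases} x^n & \text{for } 0\le n<M-1,\\ \sum_{l=n-M}^n (l+n-M+2)\,a_{l+M-n}\,x^l & \text{for } n\ge M-1.\end{cases}$$ (For $n=M-1$ the summand with $l=-1$ has coefficient $0$, so each $\phi_n$ is a polynomial.) *)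

theory Defs
  imports "HOL-Analysis.Analysis" "HOL-Computational_Algebra.Polynomial"
begin

text \<open>The index \<open>l\<close> runs over the integers because it starts at \<open>-1\<close> when \<open>n = degree Q - 1\<close>;
  the summand at \<open>l = -1\<close> is zero, so the value of \<open>nat (-1)\<close> plays no role.\<close>

definition phi :: "real poly \<Rightarrow> nat \<Rightarrow> real poly" where
  "phi Q n =
     (let M = int (degree Q) in
      if int n < M - 1 then monom 1 n
      else (\<Sum>l = int n - M..int n.
              monom (of_int (l + int n - M + 2) * coeff Q (nat (l + M - int n))) (nat l)))"

definition trans_matrix :: "real poly \<Rightarrow> nat \<Rightarrow> nat \<Rightarrow> real" where
  "trans_matrix Q l n = coeff (phi Q n) l"

text \<open>Infinite matrices are multiplied within the ring of column-finite matrices, the matrices of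
  linear maps with respect to countable bases; there all sums over \<open>k\<close> are finite.\<close>

definition column_finite :: "(nat \<Rightarrow> nat \<Rightarrow> real) \<Rightarrow> bool" where
  "column_finite A \<longleftrightarrow> (\<forall>n. finite {l. A l n \<noteq> 0})"

definition inf_mat_mult ::
    "(nat \<Rightarrow> nat \<Rightarrow> real) \<Rightarrow> (nat \<Rightarrow> nat \<Rightarrow> real) \<Rightarrow> nat \<Rightarrow> nat \<Rightarrow> real" where
  "inf_mat_mult A B l n = (\<Sum>k | B k n \<noteq> 0. A l k * B k n)"

definition inf_mat_one :: "nat \<Rightarrow> nat \<Rightarrow> real" where
  "inf_mat_one l n = (if l = n then 1 else 0)"

definition is_inf_mat_inverse :: "(nat \<Rightarrow> nat \<Rightarrow> real) \<Rightarrow> (nat \<Rightarrow> nat \<Rightarrow> real) \<Rightarrow> bool" where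
  "is_inf_mat_inverse A B \<longleftrightarrow>
     column_finite A \<and> column_finite B \<and>
     inf_mat_mult A B = inf_mat_one \<and> inf_mat_mult B A = inf_mat_one"

definition antiderivative_on :: "(real \<Rightarrow> real) \<Rightarrow> (real \<Rightarrow> real) \<Rightarrow> real set \<Rightarrow> bool" where
  "antiderivative_on F f J \<longleftrightarrow> (\<forall>x\<in>J. (F has_real_derivative f x) (at x))"

text \<open>The transition matrix has exactly one inverse, and that inverse is upper triangular.\<close>

lemma inf_mat_mult_superset:
  assumes "finite K" "{k. B k n \<noteq> 0} \<subseteq> K"
  shows "inf_mat_mult A B l n = (\<Sum>k\<in>K. A l k * B k n)"
  unfolding inf_mat_mult_def by (rule sum.mono_neutral_left) (use assms in auto)

lemma inf_mat_mult_assoc: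
  assumes B: "column_finite B" and C: "column_finite C"
  shows "inf_mat_mult (inf_mat_mult A B) C = inf_mat_mult A (inf_mat_mult B C)"
proof (intro ext)
  fix l n
  let ?K = "{k. C k n \<noteq> 0}"
  let ?J = "\<Union>k\<in>?K. {j. B j k \<noteq> 0}"
  have fin: "finite ?K" "finite ?J" using B C by (auto simp: column_finite_def)
  have sub: "{j. inf_mat_mult B C j n \<noteq> 0} \<subseteq> ?J"
  proof
    fix j assume "j \<in> {j. inf_mat_mult B C j n \<noteq> 0}"
    then have "(\<Sum>k\<in>?K. B j k * C k n) \<noteq> 0" by (simp add: inf_mat_mult_def)
    then obtain k where "k \<in> ?K" "B j k * C k n \<noteq> 0" by (meson sum.neutral)
    then show "j \<in> ?J" by auto
  qed
  have AB: "inf_mat_mult A B l k = (\<Sum>j\<in>?J. A l j * B j k)" if "k \<in> ?K" for k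
    by (rule inf_mat_mult_superset[OF fin(2)]) (use that in auto)
  have "inf_mat_mult (inf_mat_mult A B) C l n = (\<Sum>k\<in>?K. (\<Sum>j\<in>?J. A l j * B j k) * C k n)"
    unfolding inf_mat_mult_def[of "inf_mat_mult A B"] by (rule sum.cong) (use AB in auto)
  also have "\<dots> = (\<Sum>k\<in>?K. \<Sum>j\<in>?J. A l j * (B j k * C k n))"
    by (simp add: sum_distrib_right mult.assoc)
  also have "\<dots> = (\<Sum>j\<in>?J. \<Sum>k\<in>?K. A l j * (B j k * C k n))"
    by (rule sum.swap)
  also have "\<dots> = (\<Sum>j\<in>?J. A l j * inf_mat_mult B C j n)"
    by (simp add: inf_mat_mult_def[of B C] sum_distrib_left)
  also have "\<dots> = inf_mat_mult A (inf_mat_mult B C) l n"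
    using inf_mat_mult_superset[of ?J "inf_mat_mult B C" n A l] fin(2) sub by simp
  finally show "inf_mat_mult (inf_mat_mult A B) C l n = inf_mat_mult A (inf_mat_mult B C) l n" .
qed

lemma inf_mat_mult_one_right: "inf_mat_mult A inf_mat_one = A"
proof (intro ext)
  fix l n
  show "inf_mat_mult A inf_mat_one l n = A l n"
    by (subst inf_mat_mult_superset[of "{n}"]) (auto simp: inf_mat_one_def)
qed

lemma inf_mat_mult_one_left:
  assumes "column_finite A"
  shows "inf_mat_mult inf_mat_one A = A"
proof (intro ext)
  fix l n
  have "finite (insert l {k. A k n \<noteq> 0})" using assms by (auto simp: column_finite_def)
  then show "inf_mat_mult inf_mat_one A l n = A l n"
    by (subst inf_mat_mult_superset[of "insert l {k. A k n \<noteq> 0}"])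
       (auto simp: inf_mat_one_def if_distrib[of "\<lambda>c. c * _"] cong: if_cong)
qed

lemma column_finite_upper: 
  assumes "\<And>l n. n < l \<Longrightarrow> A l n = 0"
  shows "column_finite A"
  unfolding column_finite_def
proof
  fix n
  show "finite {l. A l n \<noteq> 0}"
    by (rule finite_subset[of _ "{..n}"]) (use assms[of n] in \<open>auto simp: not_less[symmetric]\<close>)
qed

lemma upper_triangular_solve:
  fixes A :: "nat \<Rightarrow> nat \<Rightarrow> real"
  assumes up: "\<And>l n. n < l \<Longrightarrow> A l n = 0" and diag: "\<And>n. A n n \<noteq> 0"
    and "\<And>l. l \<ge> m \<Longrightarrow> v l = 0"
  shows "\<exists>b. (\<forall>k\<ge>m. b k = 0) \<and> (\<forall>l. (\<Sum>k<m. A l k * b k) = v l)"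
  using assms(3)
proof (induction m arbitrary: v)
  case 0
  then show ?case by (intro exI[of _ "\<lambda>_. 0"]) auto
next
  case (Suc m)
  define c where "c = v m / A m m"
  have "v l - A l m * c = 0" if "l \<ge> m" for l
    using that Suc.prems[of l] up[of m l] diag[of m] by (cases "l = m") (auto simp: c_def)
  from Suc.IH[of "\<lambda>l. v l - A l m * c", OF this] obtain b
    where b: "\<forall>k\<ge>m. b k = 0" "\<forall>l. (\<Sum>k<m. A l k * b k) = v l - A l m * c" by auto
  have "(\<Sum>k<m. A l k * (b(m := c)) k) = (\<Sum>k<m. A l k * b k)" for l
    by (rule sum.cong) auto
  then show ?case using b by (intro exI[of _ "b(m := c)"]) auto
qed

lemma upper_triangular_right_inverse:
  fixes A :: "nat \<Rightarrow> nat \<Rightarrow> real"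
  assumes up: "\<And>l n. n < l \<Longrightarrow> A l n = 0" and diag: "\<And>n. A n n \<noteq> 0"
  shows "\<exists>B. (\<forall>l n. n < l \<longrightarrow> B l n = 0) \<and> (\<forall>n. B n n \<noteq> 0) \<and> inf_mat_mult A B = inf_mat_one"
proof -
  have "\<exists>b. (\<forall>k\<ge>Suc n. b k = 0) \<and> (\<forall>l. (\<Sum>k<Suc n. A l k * b k) = inf_mat_one l n)" for n
    by (rule upper_triangular_solve[OF up diag]) (auto simp: inf_mat_one_def)
  then obtain b where b: "\<And>n k. k \<ge> Suc n \<Longrightarrow> b n k = 0"
      "\<And>n l. (\<Sum>k<Suc n. A l k * b n k) = inf_mat_one l n" by metis
  define B where "B = (\<lambda>l n. b n l)"
  have "inf_mat_mult A B l n = inf_mat_one l n" for l n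
    unfolding b(2)[of l n, symmetric]
    by (subst inf_mat_mult_superset[of "{..<Suc n}"])
       (use b(1)[of n] in \<open>auto simp: B_def not_less[symmetric]\<close>)
  moreover have "B n n \<noteq> 0" for n
  proof -
    have "(\<Sum>k<n. A n k * b n k) = 0" by (rule sum.neutral) (use up in auto)
    with b(2)[of n n] show ?thesis by (auto simp: B_def inf_mat_one_def)
  qed
  ultimately show ?thesis using b(1) by (intro exI[of _ B]) (auto simp: B_def)
qed

lemma trans_matrix_upper:
  assumes "n < l"
  shows "trans_matrix Q l n = 0"
  using assms by (auto simp: trans_matrix_def phi_def Let_def coeff_sum intro!: sum.neutral)

lemma trans_matrix_diag:
  assumes "degree Q \<ge> 1"
  shows "trans_matrix Q n n \<noteq> 0"
proof (cases "int n < int (degree Q) - 1")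
  case True
  then show ?thesis by (simp add: trans_matrix_def phi_def)
next
  case False
  let ?M = "int (degree Q)"
  have "trans_matrix Q n n = (\<Sum>l = int n - ?M..int n.
      if l = int n then of_int (2 * int n - ?M + 2) * coeff Q (degree Q) else 0)"
    unfolding trans_matrix_def phi_def Let_def if_not_P[OF False] coeff_sum
  proof (rule sum.cong[OF refl])
    fix l assume "l \<in> {int n - ?M..int n}"
    then have "l = int n \<or> (nat l \<noteq> n \<and> l \<noteq> int n) \<or> (l = -1 \<and> n = 0 \<and> ?M = 1)"
      using False assms by auto
    then show "coeff (monom (of_int (l + int n - ?M + 2) * coeff Q (nat (l + ?M - int n))) (nat l)) n =
        (if l = int n then of_int (2 * int n - ?M + 2) * coeff Q (degree Q) else 0)"
      by auto
  qed
  also have "\<dots> = of_int (2 * int n - ?M + 2) * coeff Q (degree Q)"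
    by (subst sum.delta) auto
  also have "\<dots> \<noteq> 0" using False assms by (auto simp del: of_int_diff of_int_add)
  finally show ?thesis .
qed

lemma trans_matrix_inverse:
  assumes "degree Q \<ge> 1"
  shows "\<exists>!B. is_inf_mat_inverse (trans_matrix Q) B"
    and "is_inf_mat_inverse (trans_matrix Q) B \<Longrightarrow> n < l \<Longrightarrow> B l n = 0"
proof -
  let ?A = "trans_matrix Q"
  have cA: "column_finite ?A" by (rule column_finite_upper) (rule trans_matrix_upper)
  obtain R where R: "\<And>l n. n < l \<Longrightarrow> R l n = 0" "\<And>n. R n n \<noteq> 0"
      and AR: "inf_mat_mult ?A R = inf_mat_one"
    using upper_triangular_right_inverse[of ?A] trans_matrix_upper trans_matrix_diag[OF assms] by metis
  have cR: "column_finite R" by (rule column_finite_upper) (rule R(1))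
  obtain S where S: "\<And>l n. n < l \<Longrightarrow> S l n = 0" and RS: "inf_mat_mult R S = inf_mat_one"
    using upper_triangular_right_inverse[of R] R by metis
  have cS: "column_finite S" by (rule column_finite_upper) (rule S)
  have "?A = S"
    using inf_mat_mult_assoc[OF cR cS, of ?A] 
    by (simp add: AR RS inf_mat_mult_one_left[OF cS] inf_mat_mult_one_right)
  with RS have RA: "inf_mat_mult R ?A = inf_mat_one" by simp
  have inv: "is_inf_mat_inverse ?A R" using cA cR AR RA by (simp add: is_inf_mat_inverse_def)
  have uniq: "B = R" if "is_inf_mat_inverse ?A B" for B
    using that inf_mat_mult_assoc[OF cA cR, of B]
    by (simp add: is_inf_mat_inverse_def AR inf_mat_mult_one_left[OF cR] inf_mat_mult_one_right)
  from inv uniq show "\<exists>!B. is_inf_mat_inverse ?A B" by blast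
  show "B l n = 0" if "is_inf_mat_inverse ?A B" "n < l"
    using uniq[OF that(1)] R(1)[OF that(2)] by simp
qed

end

theory Submission
  imports Defs
begin

text \<open>
  The polynomials \<open>\<phi>\<^sub>n\<close> are made so that, for \<open>n \<ge> M - 1\<close> and with \<open>m = n + 1 - M\<close>,
  \<open>\<phi>\<^sub>n = 2 m x\<^sup>m\<^sup>-\<^sup>1 Q + x\<^sup>m Q'\<close> (\<open>poly_phi_high\<close>). The right-hand side is
  \<open>sqrt Q\<close> times the derivative of \<open>2 x\<^sup>m sqrt Q\<close>, so \<open>\<phi>\<^sub>n / sqrt Q\<close> has an elementary
  antiderivative (\<open>phi_div_sqrt_antiderivative\<close>). For \<open>n < M - 1\<close> the quotient
  \<open>\<phi>\<^sub>n / sqrt Q\<close> is the integrand of \<open>I\<^sub>n\<close>. Column \<open>n\<close> of \<open>B\<close> holds the coordinates of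
  \<open>x\<^sup>n\<close> in the basis \<open>\<phi>\<^sub>l\<close> (\<open>power_eq_sum_phi\<close>), and integrating that expansion term by
  term gives one antiderivative of \<open>x\<^sup>n / sqrt Q\<close>. Since an interval is connected, the others differ
  from it by constants (\<open>antiderivative_on_iff_differ_by_constant\<close>).
\<close>

lemma antiderivative_on_iff_differ_by_constant:
  assumes "open J" "is_interval J" and G: "antiderivative_on G f J"
  shows "antiderivative_on F f J \<longleftrightarrow> (\<exists>C. \<forall>x\<in>J. F x = G x + C)"
proof
  assume F: "antiderivative_on F f J"
  have "((\<lambda>x. F x - G x) has_real_derivative 0) (at x within J)" if "x \<in> J" for x
  proof -
    have "((\<lambda>x. F x - G x) has_real_derivative f x - f x) (at x)"
      using F G that by (intro DERIV_diff) (auto simp: antiderivative_on_def)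
    then show ?thesis by (simp add: has_field_derivative_at_within)
  qed
  then obtain C where "\<And>x. x \<in> J \<Longrightarrow> F x - G x = C"
    using has_field_derivative_zero_constant[of J "\<lambda>x. F x - G x"]
      is_interval_convex[OF assms(2)] by blast
  then show "\<exists>C. \<forall>x\<in>J. F x = G x + C" by (intro exI[of _ C]) (simp add: algebra_simps)
next
  assume "\<exists>C. \<forall>x\<in>J. F x = G x + C"
  then obtain C where C: "\<And>x. x \<in> J \<Longrightarrow> F x = G x + C" by blast
  show "antiderivative_on F f J"
    unfolding antiderivative_on_def
  proof
    fix x assume x: "x \<in> J"
    have "((\<lambda>x. G x + C) has_real_derivative f x) (at x)"
      using G x by (auto simp: antiderivative_on_def intro!: derivative_eq_intros)
    then show "(F has_real_derivative f x) (at x)"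
      by (rule has_field_derivative_transform_within_open[OF _ \<open>open J\<close> x]) (simp add: C)
  qed
qed

lemma poly_pderiv_altdef:
  fixes p :: "'a :: {comm_semiring_1, semiring_no_zero_divisors} poly"
  shows "poly (pderiv p) x = (\<Sum>j\<le>degree p. of_nat j * coeff p j * x ^ (j - 1))"
proof -
  have "pderiv p = (\<Sum>j\<le>degree p. monom (of_nat j * coeff p j) (j - 1))"
    by (subst poly_as_sum_of_monoms[of p, symmetric])
      (simp add: higher_pderiv_sum[of 1, simplified] pderiv_monom)
  then show ?thesis by (simp add: poly_sum poly_monom)
qed

lemma poly_phi_low:
  assumes "n < degree Q - 1"
  shows "poly (phi Q n) x = x ^ n"
  using assms by (simp add: phi_def Let_def poly_monom)

text \<open>After the shift \<open>l = n - M + j\<close> the coefficient \<open>l + n - M + 2\<close> in the definition of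
  \<open>\<phi>\<^sub>n\<close> becomes \<open>2 m + j\<close> with \<open>m = n + 1 - M\<close>; its two parts are the coefficients of
  \<open>2 m x\<^sup>m\<^sup>-\<^sup>1 Q\<close> and \<open>x\<^sup>m Q'\<close>. The truncated exponent \<open>m - 1\<close> is harmless because for
  \<open>m = 0\<close> it comes with the factor \<open>m\<close>.\<close>

lemma poly_phi_high:
  assumes n: "degree Q \<le> n + 1" and m: "m = n + 1 - degree Q"
  shows "poly (phi Q n) x = 2 * of_nat m * x ^ (m - 1) * poly Q x + x ^ m * poly (pderiv Q) x"
proof -
  let ?M = "int (degree Q)"
  let ?g = "\<lambda>l. of_int (l + int n - ?M + 2) * coeff Q (nat (l + ?M - int n)) * x ^ nat l"
  have "poly (phi Q n) x = (\<Sum>l = int n - ?M..int n. ?g l)"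
    using n by (simp add: phi_def Let_def poly_sum poly_monom)
  also have "\<dots> = (\<Sum>j\<le>degree Q. ?g (int n - ?M + int j))"
    by (rule sum.reindex_bij_witness[of _ "\<lambda>j. int n - ?M + int j" "\<lambda>l. nat (l + ?M - int n)"])
      auto
  also have "\<dots> = (\<Sum>j\<le>degree Q. 2 * of_nat m * x ^ (m - 1) * (coeff Q j * x ^ j)
      + x ^ m * (of_nat j * coeff Q j * x ^ (j - 1)))"
  proof (rule sum.cong[OF refl])
    fix j assume "j \<in> {..degree Q}"
    have int_m: "int n - ?M = int m - 1" using n m by simp
    have coeff_j: "coeff Q (nat (int n - ?M + int j + ?M - int n)) = coeff Q j" by simp
    have exponent: "nat (int n - ?M + int j) = m + j - 1" using int_m by simp
    have factor: "of_int (int n - ?M + int j + int n - ?M + 2) = (2 * of_nat m + of_nat j :: real)"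
      using n m by (simp add: of_nat_diff)
    have "(2 * of_nat m + of_nat j) * c * x ^ (m + j - 1) =
        2 * of_nat m * x ^ (m - 1) * (c * x ^ j) + x ^ m * (of_nat j * c * x ^ (j - 1))" for c
      by (cases m; cases j) (simp_all add: algebra_simps power_add)
    then show "?g (int n - ?M + int j) = 2 * of_nat m * x ^ (m - 1) * (coeff Q j * x ^ j)
        + x ^ m * (of_nat j * coeff Q j * x ^ (j - 1))"
      unfolding coeff_j exponent factor .
  qed
  also have "\<dots> = 2 * of_nat m * x ^ (m - 1) * poly Q x + x ^ m * poly (pderiv Q) x"
    unfolding poly_altdef[of Q] poly_pderiv_altdef sum.distrib sum_distrib_left ..
  finally show ?thesis .
qed

lemma phi_div_sqrt_antiderivative:
  assumes n: "degree Q \<le> n + 1" and pos: "poly Q x > 0"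
  shows "((\<lambda>x. 2 * (x ^ (n + 1 - degree Q) * sqrt (poly Q x))) has_real_derivative
           poly (phi Q n) x / sqrt (poly Q x)) (at x)"
proof -
  define m where "m = n + 1 - degree Q"
  define s where "s = sqrt (poly Q x)"
  have s: "s > 0" "poly Q x = s * s" using pos by (simp_all add: s_def)
  have "((\<lambda>x. 2 * (x ^ m * sqrt (poly Q x))) has_real_derivative
      2 * (of_nat m * x ^ (m - 1) * s + x ^ m * (poly (pderiv Q) x / (2 * s)))) (at x)"
    using pos by (auto intro!: derivative_eq_intros simp: s_def field_simps)
  also have "2 * (of_nat m * x ^ (m - 1) * s + x ^ m * (poly (pderiv Q) x / (2 * s))) =
      poly (phi Q n) x / s"
    unfolding poly_phi_high[OF n m_def] s(2) using s(1) by (simp add: field_simps)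
  finally show ?thesis unfolding m_def s_def .
qed

lemma power_eq_sum_phi:
  assumes "degree Q \<ge> 1" and B: "is_inf_mat_inverse (trans_matrix Q) B"
  shows "x ^ n = (\<Sum>l\<le>n. B l n * poly (phi Q l) x)"
proof -
  have "{k. B k n \<noteq> 0} \<subseteq> {..n}"
    using trans_matrix_inverse(2)[OF assms] by (auto simp: not_less[symmetric])
  then have AB: "(\<Sum>l\<le>n. trans_matrix Q k l * B l n) = inf_mat_one k n" for k
    using B inf_mat_mult_superset[of "{..n}" B n "trans_matrix Q" k]
    by (simp add: is_inf_mat_inverse_def)
  have "monom 1 n = (\<Sum>l\<le>n. smult (B l n) (phi Q l))"
  proof (rule poly_eqI)
    fix k
    show "coeff (monom 1 n) k = coeff (\<Sum>l\<le>n. smult (B l n) (phi Q l)) k"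
      using AB[of k] by (auto simp: coeff_sum trans_matrix_def inf_mat_one_def mult.commute)
  qed
  then have "poly (monom 1 n) x = poly (\<Sum>l\<le>n. smult (B l n) (phi Q l)) x" by simp
  then show ?thesis by (simp add: poly_monom poly_sum)
qed

theorem mainTheorem1:
  fixes M n :: nat
    and Q :: "real poly"
    and B :: "nat \<Rightarrow> nat \<Rightarrow> real"
    and J :: "real set"
    and I :: "nat \<Rightarrow> real \<Rightarrow> real"
    and F :: "real \<Rightarrow> real"
  assumes "M \<ge> 1"
    and "degree Q = M"
    and "card {x. poly Q x = 0} = M"
    and "\<And>x. poly Q x = 0 \<Longrightarrow> order x Q = 1"
    and "is_inf_mat_inverse (trans_matrix Q) B"
    and "int n > int M - 2"
    and "open J" and "is_interval J"
    and "\<And>x. x \<in> J \<Longrightarrow> poly Q x > 0"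
    and "\<And>l. int l \<le> int M - 2 \<Longrightarrow> antiderivative_on (I l) (\<lambda>x. x ^ l / sqrt (poly Q x)) J"
  shows "antiderivative_on F (\<lambda>x. x ^ n / sqrt (poly Q x)) J \<longleftrightarrow>
    (\<exists>C. \<forall>x\<in>J. F x = (\<Sum>l | int l \<le> int M - 2. B l n * I l x)
                     + 2 * (\<Sum>l = M - 1..n. B l n * x ^ (l + 1 - M) * sqrt (poly Q x)) + C)"
proof -
  let ?G = "\<lambda>x. (\<Sum>l | int l \<le> int M - 2. B l n * I l x)
      + 2 * (\<Sum>l = M - 1..n. B l n * x ^ (l + 1 - M) * sqrt (poly Q x))"
  have low: "{l. int l \<le> int M - 2} = {..<M - 1}" by auto
  have split: "{..n} = {..<M - 1} \<union> {M - 1..n}" using \<open>int n > int M - 2\<close> by auto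
  have "antiderivative_on ?G (\<lambda>x. x ^ n / sqrt (poly Q x)) J"
    unfolding antiderivative_on_def
  proof
    fix x assume x: "x \<in> J"
    define s where "s = sqrt (poly Q x)"
    have dI: "(I l has_real_derivative poly (phi Q l) x / s) (at x)" if "l \<in> {..<M - 1}" for l
    proof -
      have "int l \<le> int M - 2" using that by auto
      from assms(10)[OF this] x have "(I l has_real_derivative x ^ l / s) (at x)"
        by (simp add: antiderivative_on_def s_def)
      then show ?thesis using that \<open>degree Q = M\<close> by (simp add: poly_phi_low)
    qed
    have dR: "((\<lambda>x. 2 * (x ^ (l + 1 - M) * sqrt (poly Q x))) has_real_derivative
        poly (phi Q l) x / s) (at x)" if "l \<in> {M - 1..n}" for l
      using phi_div_sqrt_antiderivative[of Q l x] that assms(2) assms(9)[OF x]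
      unfolding s_def by auto
    have "((\<lambda>x. (\<Sum>l\<in>{..<M - 1}. B l n * I l x)
          + (\<Sum>l = M - 1..n. B l n * (2 * (x ^ (l + 1 - M) * sqrt (poly Q x)))))
        has_real_derivative (\<Sum>l\<in>{..<M - 1}. B l n * (poly (phi Q l) x / s))
          + (\<Sum>l = M - 1..n. B l n * (poly (phi Q l) x / s))) (at x)"
      by (intro DERIV_add DERIV_sum DERIV_cmult dI dR)
    also have "(\<Sum>l\<in>{..<M - 1}. B l n * (poly (phi Q l) x / s))
          + (\<Sum>l = M - 1..n. B l n * (poly (phi Q l) x / s))
        = (\<Sum>l\<le>n. B l n * (poly (phi Q l) x / s))"
      unfolding split by (rule sum.union_disjoint[symmetric]) auto
    also have "\<dots> = x ^ n / s"
      using power_eq_sum_phi[of Q B x n] assms(1,2,5) by (simp add: sum_divide_distrib)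
    also have "(\<lambda>x. (\<Sum>l\<in>{..<M - 1}. B l n * I l x)
          + (\<Sum>l = M - 1..n. B l n * (2 * (x ^ (l + 1 - M) * sqrt (poly Q x))))) = ?G"
      unfolding low sum_distrib_left by (simp add: mult_ac)
    finally show "(?G has_real_derivative x ^ n / sqrt (poly Q x)) (at x)"
      unfolding s_def .
  qed
  from antiderivative_on_iff_differ_by_constant[OF \<open>open J\<close> \<open>is_interval J\<close> this]
  show ?thesis .
qed

end
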